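(* Consider the $N$-player game $\mathcal{G}(V,\Omega_i,J_i)$, $V=\{1,\dots,N\}$, and the communication graph $G_c=(V,E)$. Assume: (1) for every $i\in V$, $\Omega_i\subset\mathbb{R}$ is non-empty, compact and convex, and $J_i:\mathbb{R}^N\to\mathbb{R}$, $(x_i,x_{-i})\mapsto J_i(x_i,x_{-i})$, is $C^1$ and convex in $x_i$ for every $x_{-i}$, and jointly continuous in $x$; (2) there are $\mu>0$, $\theta_0>0$ such that $\langle x-y,F(x)-F(y)\rangle\ge\mu\|x-y\|^2$ and $\|F(x)-F(y)\|\le\theta_0\|x-y\|$ for all $x,y\in\mathbb{R}^N$, where $F$ is the pseudo-gradient; (3) $G_c$ is undirected and connected (with no isolated vertex); (4) there is $\theta>0$ such that $\|\mathbf{F}(\mathbf{x})-\mathbf{F}(\mathbf{y})\|\le\theta\|\mathbf{x}-\mathbf{y}\|$ for all $\mathbf{x},\mathbf{y}\in\mathbb{R}^{N^2}$, where $\mathbf{F}$ is the extended pseudo-gradient. Take an arbitrary $c>0$ and any $c_0>c_{\min}$, where $c_{\min}\lambda_2(L)=\frac{(\theta+\theta_0)^2}{4\mu}+\theta$, and let $\bar c=c+c_0$. Let $$\Psi=\begin{bmatrix}\frac{\mu}{N} & -\frac{\theta+\theta_0}{2\sqrt N}\\ -\frac{\theta+\theta_0}{2\sqrt N} & c_0\lambda_2(L)-\theta\end{bmatrix},\qquad \bar\mu=\lambda_{\min}(\Psi),\qquad \bar\theta=\theta+2c_0d^*,$$ where $d^*$ is the maximal degree of $G_c$. If $\beta_i>0$,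 $i\in V$, are chosen such that, with $\mathbb{B}=\mathrm{diag}((\beta_i)_{i\in V})$, $$\lambda_{\min}\big(\mathbb{B}+2\bar c\,\mathbb{D}-c\,L\big)>\frac{\bar\theta^2}{2\bar\mu},$$ then for every $i\in V$ the sequence $\{x^i(k)\}$ generated by Algorithm 1 (defined in the context, with parameters $c,c_0,\beta_i$) converges to the Nash equilibrium $x^*$ of the game; equivalently, $\mathbf{x}(k)=[x^1(k);\dots;x^N(k)]$ converges to $\mathbf{1}_N\otimes x^*$.
   Context: Game: player $i\in V$ has action $x_i\in\Omega_i\subset\mathbb{R}$ and cost $J_i(x_i,x_{-i})$, $x=(x_i,x_{-i})\in\mathbb{R}^N$, where $x_{-i}$ collects the actions of all players other than $i$; $\Omega=\prod_{i}\Omega_i$. A Nash equilibrium is $x^*\in\Omega$ with $J_i(x_i^*,x_{-i}^* )\le J_i(x_i,x_{-i}^* )$ for all $x_i\in\Omega_i$, $i\in V$. (Under assumptions (1), (2) of the claim it exists and is unique.) Pseudo-gradient: $F(x)=[\nabla_iJ_i(x)]_{i\in V}\in\mathbb{R}^N$, $\nabla_iJ_i=\partial J_i/\partial x_i$. Extended pseudo-gradient: for $\mathbf{x}=[x^1;\dots;x^N]\in\mathbb{R}^{N^2}$ with $x^i\in\mathbb{R}^N$, $\mathbf{F}(\mathbf{x})=[\nabla_iJ_i(x^i)]_{i\in V}\in\mathbb{R}^N$. Graph: $N_i$ is the set of neighbours of $i$ in $G_c$; $\mathbb{D}=\mathrm{diag}(|N_1|,\dots,|N_N|)$; $L=\mathbb{D}-A$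 is the Laplacian ($A$ the adjacency matrix); $\lambda_2(L)>0$ is its smallest nonzero eigenvalue; $d^*=\max_i|N_i|$. $\lambda_{\min}$ denotes the minimum eigenvalue; $\mathbf{1}_N$ is the all-ones vector; $\otimes$ is the Kronecker product. Algorithm 1: player $i$ keeps an estimate $x^i=(x_i^i,x_{-i}^i)\in\mathbb{R}^N$ of all actions ($x_i^i=x_i$ is its own action, $x_j^i$ its estimate of player $j$'s action) and a dual vector $w^i=(w_i^i,w_{-i}^i)\in\mathbb{R}^N$. Parameters: $c>0$, $c_0>0$, $\bar c=c+c_0$, $\beta_i>0$, $\alpha_i=\beta_i+2\bar c|N_i|$. Initialization: $x_i^i(0)\in\Omega_i$, $x_{-i}^i(0)\in\mathbb{R}^{N-1}$ arbitrary, $w^i(0)=\mathbf{0}_N$. For $k=1,2,\dots$ and each $i\in V$: $$w^i(k)=w^i(k-1)+c\sum_{j\in N_i}\big(x^i(k-1)-x^j(k-1)\big),$$ $$x_i^i(k)=T_{\Omega_i}\Big\{\alpha_i^{-1}\Big[-\nabla_iJ_i(x^i(k-1))-w_i^i(k)+\beta_ix_i^i(k-1)+\bar c\sum_{j\in N_i}\big(x_i^i(k-1)+x_i^j(k-1)\big)\Big]\Big\},$$ $$x_{-i}^i(k)=\alpha_i^{-1}\Big[\beta_ix_{-i}^i(k-1)+\bar c\sum_{j\in N_i}\big(x_{-i}^i(k-1)+x_{-i}^j(k-1)\big)-w_{-i}^i(k)\Big],$$ where $T_{\Omega_i}$ is Euclidean projection onto $\Omega_i$, and $x^j_{-i}$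 denotes $x^j$ with its $i$-th component removed. *)

theory Defs
  imports "HOL-Analysis.Analysis"
begin

text \<open>
  Players are the elements of a finite type \<open>'n\<close>, so \<open>N = CARD('n)\<close>. A stacked vector
  \<open>[x\<^sup>1; \<dots>; x\<^sup>N]\<close> is an element \<open>x\<close> of \<open>real ^ 'n ^ 'n\<close> with \<open>x $ i = x\<^sup>i\<close>; its norm in
  that type is the Euclidean norm of the stacked vector.
\<close>

section \<open>The game\<close>

definition set_coord :: "real ^ 'n \<Rightarrow> 'n \<Rightarrow> real \<Rightarrow> real ^ 'n" where
  "set_coord x i t = (\<chi> j. if j = i then t else x $ j)"

definition is_nash :: "('n \<Rightarrow> real set) \<Rightarrow> ('n \<Rightarrow> real ^ 'n \<Rightarrow> real) \<Rightarrow> real ^ 'n \<Rightarrow> bool" where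
  "is_nash \<Omega> J xs \<longleftrightarrow>
     (\<forall>i. xs $ i \<in> \<Omega> i) \<and> (\<forall>i. \<forall>t\<in>\<Omega> i. J i xs \<le> J i (set_coord xs i t))"

definition partial_grad :: "('n \<Rightarrow> real ^ 'n \<Rightarrow> real) \<Rightarrow> 'n \<Rightarrow> real ^ 'n \<Rightarrow> real" where
  "partial_grad J i x = deriv (\<lambda>t. J i (set_coord x i t)) (x $ i)"

definition pseudo_grad :: "('n \<Rightarrow> real ^ 'n \<Rightarrow> real) \<Rightarrow> real ^ 'n \<Rightarrow> real ^ 'n" where
  "pseudo_grad J x = (\<chi> i. partial_grad J i x)"

definition ext_pseudo_grad ::
    "('n \<Rightarrow> real ^ 'n \<Rightarrow> real) \<Rightarrow> real ^ 'n ^ 'n \<Rightarrow> real ^ 'n" where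
  "ext_pseudo_grad J x = (\<chi> i. partial_grad J i (x $ i))"

section \<open>Graphs and matrices\<close>

text \<open>
  An undirected simple graph on \<open>'n\<close> is a symmetric irreflexive edge relation, each edge being
  present in both orientations.
\<close>

definition nbrs :: "('n \<times> 'n) set \<Rightarrow> 'n \<Rightarrow> 'n set" where
  "nbrs E i = {j. (i, j) \<in> E}"

definition connected_graph :: "('n \<times> 'n) set \<Rightarrow> bool" where
  "connected_graph E \<longleftrightarrow> (\<forall>i j. (i, j) \<in> E\<^sup>*)"

definition max_degree :: "('n::finite \<times> 'n) set \<Rightarrow> nat" where
  "max_degree E = Max (range (\<lambda>i. card (nbrs E i)))"

definition diag_matrix :: "('n \<Rightarrow> real) \<Rightarrow> real ^ 'n ^ 'n" where
  "diag_matrix d = (\<chi> i j. if i = j then d i else 0)"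

definition adj_matrix :: "('n \<times> 'n) set \<Rightarrow> real ^ 'n ^ 'n" where
  "adj_matrix E = (\<chi> i j. if (i, j) \<in> E then 1 else 0)"

definition degree_matrix :: "('n \<times> 'n) set \<Rightarrow> real ^ 'n ^ 'n" where
  "degree_matrix E = diag_matrix (\<lambda>i. real (card (nbrs E i)))"

definition laplacian :: "('n \<times> 'n) set \<Rightarrow> real ^ 'n ^ 'n" where
  "laplacian E = degree_matrix E - adj_matrix E"

definition eigenvals :: "real ^ 'n ^ 'n \<Rightarrow> real set" where
  "eigenvals A = {l. \<exists>v. v \<noteq> 0 \<and> A *v v = l *\<^sub>R v}"

text \<open>
  The two minima below range over finite sets for every square matrix. They are only used for
  symmetric matrices, whose eigenvalues are all real.
\<close>

definition lambda_min :: "real ^ 'n ^ 'n \<Rightarrow> real" where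
  "lambda_min A = Min (eigenvals A)"

definition lambda_2 :: "real ^ 'n ^ 'n \<Rightarrow> real" where
  "lambda_2 A = Min (eigenvals A - {0})"

definition Psi_matrix :: "nat \<Rightarrow> real \<Rightarrow> real \<Rightarrow> real \<Rightarrow> real \<Rightarrow> real \<Rightarrow> real ^ 2 ^ 2" where
  "Psi_matrix N \<mu> \<theta> \<theta>\<^sub>0 c\<^sub>0 l2 = vector
     [vector [\<mu> / real N, - (\<theta> + \<theta>\<^sub>0) / (2 * sqrt (real N))],
      vector [- (\<theta> + \<theta>\<^sub>0) / (2 * sqrt (real N)), c\<^sub>0 * l2 - \<theta>]]"

section \<open>The algorithm\<close>

text \<open>
  \<open>x k $ i\<close> and \<open>w k $ i\<close> are the estimate and the dual vector of player \<open>i\<close> after \<open>k\<close> steps. On a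
  non-empty closed convex set, \<^const>\<open>closest_point\<close> is the Euclidean projection.
\<close>

definition algorithm_run ::
    "('n::finite \<Rightarrow> real set) \<Rightarrow> ('n \<Rightarrow> real ^ 'n \<Rightarrow> real) \<Rightarrow> ('n \<times> 'n) set \<Rightarrow>
     real \<Rightarrow> real \<Rightarrow> ('n \<Rightarrow> real) \<Rightarrow>
     (nat \<Rightarrow> real ^ 'n ^ 'n) \<Rightarrow> (nat \<Rightarrow> real ^ 'n ^ 'n) \<Rightarrow> bool" where
  "algorithm_run \<Omega> J E c c\<^sub>0 \<beta> x w \<longleftrightarrow>
    (let cb = c + c\<^sub>0; \<alpha> = (\<lambda>i. \<beta> i + 2 * cb * real (card (nbrs E i))) in
      (\<forall>i. x 0 $ i $ i \<in> \<Omega> i) \<and>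
      (\<forall>i. w 0 $ i = 0) \<and>
      (\<forall>k i. w (Suc k) $ i = w k $ i + c *\<^sub>R (\<Sum>j\<in>nbrs E i. x k $ i - x k $ j)) \<and>
      (\<forall>k i. x (Suc k) $ i $ i =
         closest_point (\<Omega> i)
           (inverse (\<alpha> i) *
             (- partial_grad J i (x k $ i) - w (Suc k) $ i $ i + \<beta> i * x k $ i $ i
              + cb * (\<Sum>j\<in>nbrs E i. x k $ i $ i + x k $ j $ i)))) \<and>
      (\<forall>k i l. l \<noteq> i \<longrightarrow> x (Suc k) $ i $ l =
         inverse (\<alpha> i) *
           (\<beta> i * x k $ i $ l
            + cb * (\<Sum>j\<in>nbrs E i. x k $ i $ l + x k $ j $ l)
            - w (Suc k) $ i $ l)))"

end

theory Submission
  imports Defs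
begin

text \<open>
  Let \<open>e\<^sub>k = x(k) - 1 \<otimes> x\<^sup>*\<close>, \<open>u\<^sub>k = \<Sum>\<^bsub>s\<le>k\<^esub> e\<^sub>s\<close> and \<open>\<Phi> = B + 2 (c + c\<^sub>0) D - c L\<close>. The zero initialization
  of the dual variable gives \<open>w(k+1) = c L u\<^sub>k\<close>, and the projection property turns one step of the
  algorithm into the variational inequality
  \<open>\<langle>e\<^sub>k\<^sub>+\<^sub>1, \<Phi> (e\<^sub>k\<^sub>+\<^sub>1 - e\<^sub>k) + T x(k) - T (1 \<otimes> x\<^sup>*) + c L u\<^sub>k\<^sub>+\<^sub>1\<rangle> \<le> 0\<close>, where \<open>T\<close> is the extended
  pseudo-gradient (placed in the own coordinates) plus \<open>c\<^sub>0 L\<close>; the optimal dual variable is \<open>0\<close>. Polarization of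
  the two symmetric forms, the restricted strong monotonicity of \<open>T\<close> at \<open>1 \<otimes> x\<^sup>*\<close> with constant \<open>\<mu>_bar\<close>
  and its Lipschitz constant \<open>\<theta>_bar\<close> show that
  \<open>V\<^sub>k = \<langle>e\<^sub>k, \<Phi> e\<^sub>k\<rangle> + c \<langle>u\<^sub>k, L u\<^sub>k\<rangle>\<close> decreases by at least \<open>\<epsilon> \<parallel>e\<^sub>k\<parallel>\<^sup>2\<close> with
  \<open>\<epsilon> = 2 \<mu>_bar - \<theta>_bar\<^sup>2 / \<lambda>\<^sub>m\<^sub>i\<^sub>n(\<Phi>) > 0\<close>. Hence \<open>e\<^sub>k\<close> is square summable.
\<close>

section \<open>Eigenvalues of symmetric matrices\<close>

text \<open>Near \<open>t = 0\<close> the linear term dominates. This is the first-order optimality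
  condition for the Rayleigh minimizer below.\<close>

lemma linear_coeff_zero_if_quadratic_nonneg:
  fixes a b :: real
  assumes "\<And>t. 0 \<le> 2 * t * b + t\<^sup>2 * a"
  shows "b = 0"
proof (rule ccontr)
  assume "b \<noteq> 0"
  \<comment> \<open>With \<open>s > 0\<close> and \<open>s > a\<close>, the witness
    \<open>t = - b / s\<close> gives \<open>(b / s)\<^sup>2 * (a - 2 * s) < 0\<close>, whatever the
    sign of \<open>a\<close>.\<close>
  define s where "s = \<bar>a\<bar> + 1"
  have s: "s > 0" "a < s" "s \<noteq> 0" by (auto simp: s_def)
  have "2 * (- b / s) * b + (- b / s)\<^sup>2 * a = (b / s)\<^sup>2 * (a - 2 * s)"
    using s(3) by (simp add: field_simps power2_eq_square)
  moreover have "\<dots> < 0"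
    using s \<open>b \<noteq> 0\<close> by (intro mult_pos_neg) auto
  ultimately show False using assms[of "- b / s"] by linarith
qed

lemma inner_symmetric_matrix:
  fixes A :: "real ^ 'n ^ 'n"
  assumes "transpose A = A"
  shows "x \<bullet> (A *v y) = (A *v x) \<bullet> y"
  by (metis assms dot_lmul_matrix vector_transpose_matrix)

text \<open>The quadratic form attains its minimum on the compact unit sphere of \<open>S\<close>.
  The residual \<open>A *v v - m *\<^sub>R v\<close> stays in \<open>S\<close> by invariance, and
  perturbing the minimizer along it forces it to vanish. The choice \<open>S = UNIV\<close> serves
  \<open>lambda_min\<close>; the zero-sum vectors serve \<open>lambda_2\<close>.\<close>

lemma symmetric_rayleigh_minimizer:
  fixes A :: "real ^ 'n ^ 'n"
  assumes sym: "transpose A = A"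
    and S: "subspace S" "S \<noteq> {0}"
    and inv: "\<And>x. x \<in> S \<Longrightarrow> A *v x \<in> S"
  obtains v m where "v \<in> S" "v \<noteq> 0" "A *v v = m *\<^sub>R v"
    "\<And>x. x \<in> S \<Longrightarrow> m * (norm x)\<^sup>2 \<le> x \<bullet> (A *v x)"
proof -
  define K where "K = S \<inter> sphere 0 1"
  have "compact K"
    unfolding K_def using closed_subspace[OF S(1)] by (intro closed_Int_compact) auto
  have normalize: "(1 / norm y) *\<^sub>R y \<in> K" if "y \<in> S" "y \<noteq> 0" for y
    using that S(1) by (auto simp: K_def subspace_scale)
  obtain y where "y \<in> S" "y \<noteq> 0" using S subspace_0[OF S(1)] by blast
  then have "K \<noteq> {}" using normalize by blast
  have "continuous_on K (\<lambda>x. x \<bullet> (A *v x))"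
    by (intro continuous_intros linear_continuous_on matrix_vector_mul_bounded_linear)
  then obtain v where v: "v \<in> K" "\<And>x. x \<in> K \<Longrightarrow> v \<bullet> (A *v v) \<le> x \<bullet> (A *v x)"
    using continuous_attains_inf[OF \<open>compact K\<close> \<open>K \<noteq> {}\<close>] by blast
  define m where "m = v \<bullet> (A *v v)"
  have vS: "v \<in> S" and vn: "norm v = 1" using v by (auto simp: K_def)
  have min: "m * (norm x)\<^sup>2 \<le> x \<bullet> (A *v x)" if "x \<in> S" for x
  proof (cases "x = 0")
    case False
    have "m \<le> ((1 / norm x) *\<^sub>R x) \<bullet> (A *v ((1 / norm x) *\<^sub>R x))"
      using v(2)[OF normalize[OF that False]] by (simp add: m_def)
    also have "\<dots> = (x \<bullet> (A *v x)) / (norm x)\<^sup>2"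
      by (simp add: matrix_vector_mult_scaleR power2_eq_square)
    finally show ?thesis using False by (simp add: field_simps)
  qed simp
  define y where "y = A *v v - m *\<^sub>R v"
  have yS: "y \<in> S"
    unfolding y_def using vS inv S(1) by (intro subspace_diff subspace_scale) auto
  \<comment> \<open>The first-order coefficient
    \<open>y \<bullet> (A *v v) - m * (y \<bullet> v)\<close> is exactly
    \<open>y \<bullet> y\<close>, so optimality kills the residual.\<close>
  have "0 \<le> 2 * t * (y \<bullet> y) + t\<^sup>2 * (y \<bullet> (A *v y) - m * (y \<bullet> y))" for t
  proof -
    have "m * (norm (v + t *\<^sub>R y))\<^sup>2 \<le> (v + t *\<^sub>R y) \<bullet> (A *v (v + t *\<^sub>R y))"
      using vS yS S(1) by (intro min subspace_add subspace_scale)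
    also have "\<dots> = v \<bullet> (A *v v) + 2 * t * (y \<bullet> (A *v v)) + t\<^sup>2 * (y \<bullet> (A *v y))"
      using inner_symmetric_matrix[OF sym, of v y]
      by (simp add: matrix_vector_right_distrib matrix_vector_mult_scaleR inner_add_left
          inner_add_right inner_commute power2_eq_square algebra_simps)
    finally have *: "m * (norm (v + t *\<^sub>R y))\<^sup>2 \<le> \<dots>" .
    have "(norm (v + t *\<^sub>R y))\<^sup>2 = 1 + 2 * t * (y \<bullet> v) + t\<^sup>2 * (y \<bullet> y)"
      using vn unfolding power2_norm_eq_inner norm_eq_1
      by (simp add: inner_add_left inner_add_right inner_commute power2_eq_square algebra_simps)
    moreover have "y \<bullet> (A *v v) = y \<bullet> y + m * (y \<bullet> v)"
      by (simp add: y_def inner_diff_left inner_diff_right algebra_simps)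
    ultimately show ?thesis using * by (simp add: m_def algebra_simps)
  qed
  then have "y \<bullet> y = 0" by (rule linear_coeff_zero_if_quadratic_nonneg)
  then have "A *v v = m *\<^sub>R v" by (simp add: y_def)
  moreover have "v \<noteq> 0" using vn by auto
  ultimately show thesis using that vS min by blast
qed

text \<open>Eigenvectors for distinct eigenvalues are orthogonal, hence independent. Finiteness is
  what gives \<open>Min\<close> its meaning in \<open>lambda_min\<close> and
  \<open>lambda_2\<close>.\<close>

lemma finite_eigenvals_symmetric:
  fixes A :: "real ^ 'n ^ 'n"
  assumes "transpose A = A"
  shows "finite (eigenvals A)"
proof -
  define v where "v l = (SOME v. v \<noteq> 0 \<and> A *v v = l *\<^sub>R v)" for l
  have "v l \<noteq> 0 \<and> A *v v l = l *\<^sub>R v l" if "l \<in> eigenvals A" for l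
    unfolding v_def by (rule someI_ex) (use that in \<open>auto simp: eigenvals_def\<close>)
  then have v: "v l \<noteq> 0" "A *v v l = l *\<^sub>R v l" if "l \<in> eigenvals A" for l
    using that by blast+
  have orth: "v l \<bullet> v k = 0" if "l \<in> eigenvals A" "k \<in> eigenvals A" "l \<noteq> k" for l k
    using inner_symmetric_matrix[OF assms, of "v l" "v k"] v that by simp
  have inj: "inj_on v (eigenvals A)"
    by (rule inj_onI) (metis inner_eq_zero_iff orth v(1))
  have "independent (v ` eigenvals A)"
    using orth v by (intro pairwise_orthogonal_independent)
      (auto simp: pairwise_def orthogonal_def)
  then have "finite (v ` eigenvals A)" by (rule independent_imp_finite)
  then show ?thesis using inj by (rule finite_imageD)
qed

lemma symmetric_lambda_min:
  fixes A :: "real ^ 'n ^ 'n"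
  assumes "transpose A = A"
  shows lambda_min_in_eigenvals: "lambda_min A \<in> eigenvals A"
    and lambda_min_rayleigh: "lambda_min A * (norm x)\<^sup>2 \<le> x \<bullet> (A *v x)"
proof -
  have "UNIV \<noteq> {0 :: real ^ 'n}"
    by (metis UNIV_I axis_eq_0_iff singletonD zero_neq_one)
  then obtain v m where v: "v \<noteq> 0" "A *v v = m *\<^sub>R v"
    and m: "\<And>x. m * (norm x)\<^sup>2 \<le> x \<bullet> (A *v x)"
    using symmetric_rayleigh_minimizer[OF assms, of UNIV] by auto
  have "m \<in> eigenvals A" using v by (auto simp: eigenvals_def)
  then show "lambda_min A \<in> eigenvals A"
    unfolding lambda_min_def using finite_eigenvals_symmetric[OF assms] by (intro Min_in) auto
  have "lambda_min A \<le> m"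
    unfolding lambda_min_def
    using finite_eigenvals_symmetric[OF assms] \<open>m \<in> eigenvals A\<close> by simp
  then show "lambda_min A * (norm x)\<^sup>2 \<le> x \<bullet> (A *v x)"
    by (meson m mult_right_mono order_trans zero_le_power2)
qed

lemma lambda_min_pos:
  fixes A :: "real ^ 'n ^ 'n"
  assumes "transpose A = A" and pos: "\<And>v. v \<noteq> 0 \<Longrightarrow> 0 < v \<bullet> (A *v v)"
  shows "0 < lambda_min A"
proof -
  obtain v where v: "v \<noteq> 0" "A *v v = lambda_min A *\<^sub>R v"
    using lambda_min_in_eigenvals[OF assms(1)] by (auto simp: eigenvals_def)
  then have "0 < lambda_min A * (v \<bullet> v)" using pos[OF v(1)] by simp
  then show ?thesis using v(1) by (metis inner_gt_zero_iff zero_less_mult_pos2)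
qed

section \<open>The two-by-two matrix Psi\<close>

lemma quadratic_form_2:
  "x \<bullet> (vector [vector [p, q], vector [q, r]] *v x) =
     p * (x $ 1)\<^sup>2 + 2 * q * (x $ 1) * (x $ 2) + r * (x $ 2)\<^sup>2" for x :: "real ^ 2"
  by (simp add: inner_vec_def matrix_vector_mult_def sum_2 power2_eq_square algebra_simps)

lemma transpose_symmetric_2:
  "transpose (vector [vector [p, q], vector [q, r]]) = (vector [vector [p, q], vector [q, r]] :: real ^ 2 ^ 2)"
  by (simp add: transpose_def vec_eq_iff forall_2)

lemma Psi_matrix_quadratic_form:
  fixes a b \<mu> \<theta> \<theta>\<^sub>0 c\<^sub>0 l2 :: real and N :: nat
  defines "P \<equiv> Psi_matrix N \<mu> \<theta> \<theta>\<^sub>0 c\<^sub>0 l2"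
  shows "lambda_min P * (a\<^sup>2 + b\<^sup>2) \<le>
    \<mu> / N * a\<^sup>2 - (\<theta> + \<theta>\<^sub>0) / sqrt N * a * b + (c\<^sub>0 * l2 - \<theta>) * b\<^sup>2"
proof -
  have "transpose P = P" by (simp add: P_def Psi_matrix_def transpose_symmetric_2)
  from lambda_min_rayleigh[OF this, of "vector [a, b]"]
  have ray: "lambda_min P * (norm (vector [a, b] :: real ^ 2))\<^sup>2
      \<le> \<mu> / N * a\<^sup>2 + 2 * (- (\<theta> + \<theta>\<^sub>0) / (2 * sqrt N)) * a * b + (c\<^sub>0 * l2 - \<theta>) * b\<^sup>2"
    unfolding P_def Psi_matrix_def quadratic_form_2 vector_2 .
  have norm: "(norm (vector [a, b] :: real ^ 2))\<^sup>2 = a\<^sup>2 + b\<^sup>2"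
    unfolding power2_norm_eq_inner by (simp add: inner_vec_def sum_2 power2_eq_square)
  \<comment> \<open>The case \<open>s = 0\<close> covers \<open>N = 0\<close>, where both sides
    vanish by the convention for division by zero.\<close>
  have off: "2 * (- p / (2 * s)) * a * b = - (p / s * a * b)" for p s
    by (cases "s = 0") (auto simp: field_simps)
  show ?thesis using ray unfolding norm off by linarith
qed

text \<open>After rescaling the first coordinate by \<open>1 / sqrt N\<close>, completing the square
  leaves the Schur complement \<open>r - s\<^sup>2 / \<mu>\<close>. The lower bound on
  \<open>c\<^sub>0 * l2\<close> says exactly that it is positive.\<close>

lemma Psi_matrix_lambda_min_pos:
  assumes "N > 0" "\<mu> > 0" "(\<theta> + \<theta>\<^sub>0)\<^sup>2 / (4 * \<mu>) + \<theta> < c\<^sub>0 * l2"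
  shows "0 < lambda_min (Psi_matrix N \<mu> \<theta> \<theta>\<^sub>0 c\<^sub>0 l2)"
proof (rule lambda_min_pos)
  show "transpose (Psi_matrix N \<mu> \<theta> \<theta>\<^sub>0 c\<^sub>0 l2) = Psi_matrix N \<mu> \<theta> \<theta>\<^sub>0 c\<^sub>0 l2"
    by (simp add: Psi_matrix_def transpose_symmetric_2)
  fix v :: "real ^ 2" assume "v \<noteq> 0"
  define a b s r where "a = v $ 1 / sqrt N" and "b = v $ 2" and "s = (\<theta> + \<theta>\<^sub>0) / 2"
    and "r = c\<^sub>0 * l2 - \<theta>"
  have a1: "v $ 1 = sqrt N * a" using assms(1) by (simp add: a_def)
  have r: "s\<^sup>2 / \<mu> < r" using assms(3) by (simp add: s_def r_def power_divide)
  have "v \<bullet> (Psi_matrix N \<mu> \<theta> \<theta>\<^sub>0 c\<^sub>0 l2 *v v) = \<mu> * a\<^sup>2 - 2 * s * a * b + r * b\<^sup>2"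
    using assms(1) unfolding Psi_matrix_def quadratic_form_2 a1
    by (simp add: b_def s_def r_def power_mult_distrib power_divide field_simps)
  also have "\<dots> = \<mu> * (a - s / \<mu> * b)\<^sup>2 + (r - s\<^sup>2 / \<mu>) * b\<^sup>2"
    using assms(2) by (simp add: field_simps power2_eq_square)
  also have "\<dots> > 0"
  proof (cases "b = 0")
    case True
    then have "a \<noteq> 0" using \<open>v \<noteq> 0\<close> a1 by (auto simp: b_def vec_eq_iff forall_2)
    then show ?thesis using True assms(2) by simp
  next
    case False
    then show ?thesis using r assms(2) by (intro add_nonneg_pos) auto
  qed
  finally show "0 < v \<bullet> (Psi_matrix N \<mu> \<theta> \<theta>\<^sub>0 c\<^sub>0 l2 *v v)" .
qed

section \<open>The graph Laplacian\<close>

lemma transpose_laplacian: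
  assumes "sym E"
  shows "transpose (laplacian E) = laplacian E"
  by (auto simp: laplacian_def degree_matrix_def diag_matrix_def adj_matrix_def transpose_def
      vec_eq_iff dest: symD[OF assms])

lemma laplacian_mult_vector_nth:
  fixes E :: "('n::finite \<times> 'n) set"
  shows "(laplacian E *v v) $ i = (\<Sum>j\<in>nbrs E i. v $ i - v $ j)"
proof -
  have "(laplacian E *v v) $ i =
      (\<Sum>j\<in>UNIV. (if i = j then real (card (nbrs E i)) * v $ j else 0) - (if j \<in> nbrs E i then v $ j else 0))"
    unfolding matrix_vector_mult_def
    by (auto simp: laplacian_def degree_matrix_def diag_matrix_def adj_matrix_def nbrs_def
        left_diff_distrib intro!: sum.cong)
  also have "\<dots> = card (nbrs E i) * v $ i - (\<Sum>j\<in>nbrs E i. v $ j)"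
    by (simp add: sum_subtractf sum.inter_restrict[symmetric])
  finally show ?thesis by (simp add: sum_subtractf)
qed

lemma sum_nbrs_swap:
  fixes E :: "('n::finite \<times> 'n) set" and f :: "'n \<Rightarrow> 'n \<Rightarrow> 'a::comm_monoid_add"
  assumes "sym E"
  shows "(\<Sum>i\<in>UNIV. \<Sum>j\<in>nbrs E i. f i j) = (\<Sum>i\<in>UNIV. \<Sum>j\<in>nbrs E i. f j i)"
proof -
  have "(\<Sum>i\<in>UNIV. \<Sum>j\<in>nbrs E i. f i j) = (\<Sum>j\<in>UNIV. \<Sum>i | j \<in> nbrs E i. f i j)"
    using sum.swap_restrict[of UNIV UNIV f "\<lambda>i j. j \<in> nbrs E i"] by simp
  moreover have "{i. j \<in> nbrs E i} = nbrs E j" for j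
    by (auto simp: nbrs_def dest: symD[OF assms])
  ultimately show ?thesis by simp
qed

text \<open>Each edge occurs in both orientations. Averaging the terms of the two orientations turns
  \<open>v $ i * (v $ i - v $ j)\<close> into half a square.\<close>

lemma laplacian_quadratic_form:
  fixes E :: "('n::finite \<times> 'n) set"
  assumes "sym E"
  shows "v \<bullet> (laplacian E *v v) = (\<Sum>i\<in>UNIV. \<Sum>j\<in>nbrs E i. (v $ i - v $ j)\<^sup>2) / 2"
proof -
  have "v \<bullet> (laplacian E *v v) = (\<Sum>i\<in>UNIV. \<Sum>j\<in>nbrs E i. v $ i * (v $ i - v $ j))"
    by (simp add: inner_vec_def laplacian_mult_vector_nth sum_distrib_left)
  moreover from this have "v \<bullet> (laplacian E *v v) = (\<Sum>i\<in>UNIV. \<Sum>j\<in>nbrs E i. v $ j * (v $ j - v $ i))"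
    by (subst (asm) sum_nbrs_swap[OF assms])
  ultimately have "2 * (v \<bullet> (laplacian E *v v)) =
      (\<Sum>i\<in>UNIV. \<Sum>j\<in>nbrs E i. v $ i * (v $ i - v $ j) + v $ j * (v $ j - v $ i))"
    by (simp add: sum.distrib)
  also have "\<dots> = (\<Sum>i\<in>UNIV. \<Sum>j\<in>nbrs E i. (v $ i - v $ j)\<^sup>2)"
    by (intro sum.cong) (auto simp: power2_eq_square algebra_simps)
  finally show ?thesis by simp
qed

lemma laplacian_nonneg:
  assumes "sym E"
  shows "0 \<le> v \<bullet> (laplacian E *v v)"
  by (simp add: laplacian_quadratic_form[OF assms] sum_nonneg)

text \<open>A vanishing sum of squares forces equality along every edge, and connectedness spreads
  it along paths.\<close>

lemma laplacian_kernel: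
  fixes E :: "('n::finite \<times> 'n) set"
  assumes "sym E" "connected_graph E" "laplacian E *v v = 0"
  shows "v $ i = v $ j"
proof -
  have "(\<Sum>i\<in>UNIV. \<Sum>j\<in>nbrs E i. (v $ i - v $ j)\<^sup>2) = 0"
    using laplacian_quadratic_form[OF assms(1), of v] assms(3) by simp
  then have edge: "v $ a = v $ b" if "(a, b) \<in> E" for a b
    using that by (auto simp: sum_nonneg_eq_0_iff sum_nonneg nbrs_def)
  have "(i, j) \<in> E\<^sup>*" using assms(2) by (simp add: connected_graph_def)
  then show ?thesis by (induction rule: rtrancl_induct) (auto dest: edge)
qed

text \<open>The zero-sum subspace is invariant and meets the kernel, which consists of constant
  vectors, only in 0. The Rayleigh minimum \<open>m\<close> on it is therefore a nonzero eigenvalue,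
  so \<open>lambda_2\<close> is at most \<open>m\<close>.\<close>

lemma laplacian_lambda_2:
  fixes E :: "('n::finite \<times> 'n) set"
  assumes E: "sym E" "connected_graph E" and card: "CARD('n) \<ge> 2"
  shows lambda_2_pos: "0 < lambda_2 (laplacian E)"
    and lambda_2_rayleigh:
      "(\<Sum>i\<in>UNIV. z $ i) = 0 \<Longrightarrow> lambda_2 (laplacian E) * (norm z)\<^sup>2 \<le> z \<bullet> (laplacian E *v z)"
proof -
  let ?L = "laplacian E"
  define S where "S = {z :: real ^ 'n. (\<Sum>i\<in>UNIV. z $ i) = 0}"
  have fin: "finite (eigenvals ?L)"
    by (intro finite_eigenvals_symmetric transpose_laplacian E)
  have S: "subspace S"
    by (auto simp: S_def subspace_def sum.distrib sum_distrib_left[symmetric])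
  obtain a b :: 'n where "a \<noteq> b"
    using card card_le_Suc0_iff_eq[of "UNIV :: 'n set"] by auto
  \<comment> \<open>Two distinct players supply a nonzero zero-sum vector, so the sphere in
    \<open>S\<close> is non-empty.\<close>
  then have "axis a 1 - axis b 1 \<in> S" "axis a 1 - axis b 1 \<noteq> (0 :: real ^ 'n)"
    by (auto simp: S_def sum_subtractf axis_def vec_eq_iff)
  then have "S \<noteq> {0}" by blast
  have "?L *v z \<in> S" for z
  proof -
    \<comment> \<open>The entries of \<open>?L *v z\<close> sum to a quantity equal to its own
      negative once edges are reversed.\<close>
    have "(\<Sum>i\<in>UNIV. \<Sum>j\<in>nbrs E i. z $ i - z $ j) = (\<Sum>i\<in>UNIV. \<Sum>j\<in>nbrs E i. z $ j - z $ i)"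
      by (rule sum_nbrs_swap[OF E(1)])
    also have "\<dots> = - (\<Sum>i\<in>UNIV. \<Sum>j\<in>nbrs E i. z $ i - z $ j)"
      unfolding sum_negf[symmetric] by simp
    finally show ?thesis by (simp add: S_def laplacian_mult_vector_nth)
  qed
  then obtain v m where v: "v \<in> S" "v \<noteq> 0" "?L *v v = m *\<^sub>R v"
    and m: "\<And>x. x \<in> S \<Longrightarrow> m * (norm x)\<^sup>2 \<le> x \<bullet> (?L *v x)"
    using symmetric_rayleigh_minimizer[OF transpose_laplacian[OF E(1)] S \<open>S \<noteq> {0}\<close>] by metis
  have "m \<noteq> 0"
  proof
    assume "m = 0"
    then have const: "v $ i = v $ a" for i
      using laplacian_kernel[OF E, of v] v by auto
    have "(\<Sum>i\<in>UNIV. v $ i) = (\<Sum>i\<in>(UNIV :: 'n set). v $ a)"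
      by (intro sum.cong const) simp
    then have "v $ a = 0" using v(1) by (simp add: S_def)
    then have "v $ i = 0" for i using const[of i] by simp
    then show False using v(2) by (simp add: vec_eq_iff)
  qed
  then have mem: "m \<in> eigenvals ?L - {0}" using v by (auto simp: eigenvals_def)
  have "l > 0" if l: "l \<in> eigenvals ?L - {0}" for l
  proof -
    obtain u where u: "u \<noteq> 0" "?L *v u = l *\<^sub>R u" using l by (auto simp: eigenvals_def)
    have "0 \<le> l * (u \<bullet> u)" using laplacian_nonneg[OF E(1), of u] u by simp
    moreover have "0 < u \<bullet> u" using u by simp
    ultimately show ?thesis using l by (simp add: zero_le_mult_iff)
  qed
  moreover have "lambda_2 ?L \<in> eigenvals ?L - {0}"
    unfolding lambda_2_def using fin mem by (intro Min_in) auto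
  ultimately show "0 < lambda_2 ?L" by blast
  have "lambda_2 ?L \<le> m" unfolding lambda_2_def using fin mem by simp
  then show "lambda_2 ?L * (norm z)\<^sup>2 \<le> z \<bullet> (?L *v z)" if "(\<Sum>i\<in>UNIV. z $ i) = 0"
    using that by (intro order_trans[OF mult_right_mono m]) (auto simp: S_def)
qed

lemma card_nbrs_le_max_degree:
  fixes E :: "('n::finite \<times> 'n) set"
  shows "card (nbrs E i) \<le> max_degree E"
  by (simp add: max_degree_def)

text \<open>For a matrix \<open>y\<close> with rows \<open>y $ i\<close>, the product \<open>A ** y\<close> is the action of \<open>A \<otimes> I\<close> on the
  stacked vector.\<close>

lemma inner_columns:
  fixes x y :: "real ^ 'm ^ 'n"
  shows "x \<bullet> y = (\<Sum>l\<in>UNIV. column l x \<bullet> column l y)"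
  unfolding inner_vec_def column_def by (subst sum.swap) simp

lemma column_matrix_mult: "column l (A ** y) = A *v column l y"
  by (simp add: column_def matrix_matrix_mult_def matrix_vector_mult_def vec_eq_iff)

lemma inner_matrix_mult_columns:
  fixes A :: "real ^ 'n ^ 'n" and x y :: "real ^ 'm ^ 'n"
  shows "x \<bullet> (A ** y) = (\<Sum>l\<in>UNIV. column l x \<bullet> (A *v column l y))"
  by (simp add: inner_columns column_matrix_mult)

lemma inner_symmetric_matrix_mult:
  fixes A :: "real ^ 'n ^ 'n" and x y :: "real ^ 'm ^ 'n"
  assumes "transpose A = A"
  shows "x \<bullet> (A ** y) = y \<bullet> (A ** x)"
  unfolding inner_matrix_mult_columns using inner_symmetric_matrix[OF assms]
  by (metis (no_types, lifting) inner_commute)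

lemma norm_columns:
  fixes x :: "real ^ 'm ^ 'n"
  shows "(norm x)\<^sup>2 = (\<Sum>l\<in>UNIV. (norm (column l x))\<^sup>2)"
  by (simp add: power2_norm_eq_inner inner_columns)

lemma lambda_min_rayleigh_stacked:
  fixes A :: "real ^ 'n ^ 'n" and x :: "real ^ 'm ^ 'n"
  assumes "transpose A = A"
  shows "lambda_min A * (norm x)\<^sup>2 \<le> x \<bullet> (A ** x)"
  unfolding inner_matrix_mult_columns norm_columns sum_distrib_left
  by (intro sum_mono lambda_min_rayleigh assms)

lemma laplacian_nonneg_stacked:
  fixes x :: "real ^ 'm ^ 'n"
  assumes "sym E"
  shows "0 \<le> x \<bullet> (laplacian E ** x)"
  unfolding inner_matrix_mult_columns by (intro sum_nonneg laplacian_nonneg assms)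

lemma lambda_2_rayleigh_stacked:
  fixes E :: "('n::finite \<times> 'n) set" and z :: "real ^ 'm ^ 'n"
  assumes "sym E" "connected_graph E" "CARD('n) \<ge> 2" and "(\<Sum>i\<in>UNIV. z $ i) = 0"
  shows "lambda_2 (laplacian E) * (norm z)\<^sup>2 \<le> z \<bullet> (laplacian E ** z)"
proof -
  have "(\<Sum>i\<in>UNIV. column l z $ i) = 0" for l
    using arg_cong[OF assms(4), of "\<lambda>u. u $ l"] by (simp add: column_def)
  then show ?thesis
    unfolding inner_matrix_mult_columns norm_columns sum_distrib_left
    by (intro sum_mono lambda_2_rayleigh assms)
qed

lemma laplacian_mult_nth:
  fixes E :: "('n::finite \<times> 'n) set" and x :: "real ^ 'm ^ 'n"
  shows "(laplacian E ** x) $ i = (\<Sum>j\<in>nbrs E i. x $ i - x $ j)"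
proof -
  have "(laplacian E ** x) $ i $ l = (laplacian E *v column l x) $ i" for l
    using arg_cong[OF column_matrix_mult[of l "laplacian E" x], of "\<lambda>u. u $ i"]
    by (simp add: column_def)
  then show ?thesis by (simp add: vec_eq_iff laplacian_mult_vector_nth column_def)
qed

lemma diag_matrix_mult_nth:
  fixes x :: "real ^ 'm ^ 'n"
  shows "(diag_matrix d ** x) $ i $ l = d i * x $ i $ l"
  by (simp add: matrix_matrix_mult_def diag_matrix_def if_distrib[of "\<lambda>t. t * _"] cong: if_cong)

lemma laplacian_mult_replicated:
  fixes E :: "('n::finite \<times> 'n) set"
  shows "laplacian E ** (\<chi> i. y) = 0"
  by (simp add: vec_eq_iff[where x = "laplacian E ** _"] laplacian_mult_nth)

text \<open>The degree part and the adjacency part of the Laplacian are each bounded by the maximal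
  degree; this is the source of the factor 2.\<close>

lemma laplacian_norm_bound:
  fixes E :: "('n::finite \<times> 'n) set" and x :: "real ^ 'm ^ 'n"
  assumes "sym E"
  shows "norm (laplacian E ** x) \<le> 2 * max_degree E * norm x"
proof -
  define d where "d = real (max_degree E)"
  let ?D = "\<chi> i. real (card (nbrs E i)) *\<^sub>R x $ i" and ?A = "\<chi> i. \<Sum>j\<in>nbrs E i. x $ j"
  have deg: "real (card (nbrs E i)) \<le> d" for i
    unfolding d_def using card_nbrs_le_max_degree by (simp add: of_nat_mono)
  have "d \<ge> 0" by (simp add: d_def)
  have norm2: "(norm y)\<^sup>2 = (\<Sum>i\<in>UNIV. (norm (y $ i))\<^sup>2)" for y :: "real ^ 'm ^ 'n"
    by (simp add: power2_norm_eq_inner inner_vec_def)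
  have "(norm ?D)\<^sup>2 \<le> (\<Sum>i\<in>UNIV. (d * norm (x $ i))\<^sup>2)"
    unfolding norm2 by (intro sum_mono power_mono) (auto intro!: mult_right_mono deg)
  also have "\<dots> = (d * norm x)\<^sup>2"
    unfolding power_mult_distrib norm2 sum_distrib_left ..
  finally have D: "norm ?D \<le> d * norm x"
    by (rule power2_le_imp_le) (simp add: \<open>d \<ge> 0\<close>)
  have "(norm ?A)\<^sup>2 \<le> (\<Sum>i\<in>UNIV. (\<Sum>j\<in>nbrs E i. norm (x $ j))\<^sup>2)"
    unfolding norm2 by (intro sum_mono power_mono) (auto intro!: norm_sum)
  also have "\<dots> \<le> (\<Sum>i\<in>UNIV. d * (\<Sum>j\<in>nbrs E i. (norm (x $ j))\<^sup>2))"
  proof (intro sum_mono)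
    fix i
    \<comment> \<open>Cauchy-Schwarz against the constant 1 costs one factor of the degree. The
      second factor comes from counting each row once per neighbour after the swap.\<close>
    have "(\<Sum>j\<in>nbrs E i. norm (x $ j))\<^sup>2 \<le> (\<Sum>j\<in>nbrs E i. 1\<^sup>2) * (\<Sum>j\<in>nbrs E i. (norm (x $ j))\<^sup>2)"
      using Cauchy_Schwarz_ineq_sum[of "\<lambda>_. 1" "\<lambda>j. norm (x $ j)" "nbrs E i"] by simp
    also have "\<dots> \<le> d * (\<Sum>j\<in>nbrs E i. (norm (x $ j))\<^sup>2)"
      by (intro mult_right_mono) (auto simp: deg sum_nonneg)
    finally show "(\<Sum>j\<in>nbrs E i. norm (x $ j))\<^sup>2 \<le> d * (\<Sum>j\<in>nbrs E i. (norm (x $ j))\<^sup>2)" .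
  qed
  also have "\<dots> = d * (\<Sum>i\<in>UNIV. \<Sum>j\<in>nbrs E i. (norm (x $ i))\<^sup>2)"
    unfolding sum_distrib_left[symmetric] by (subst sum_nbrs_swap[OF assms]) (rule refl)
  also have "\<dots> \<le> d * (\<Sum>i\<in>UNIV. d * (norm (x $ i))\<^sup>2)"
    using \<open>d \<ge> 0\<close> by (intro mult_left_mono sum_mono) (auto intro!: mult_right_mono deg)
  also have "\<dots> = (d * norm x)\<^sup>2"
    unfolding power_mult_distrib norm2 sum_distrib_left power2_eq_square[of d] mult.assoc ..
  finally have A: "norm ?A \<le> d * norm x"
    by (rule power2_le_imp_le) (simp add: \<open>d \<ge> 0\<close>)
  have "laplacian E ** x = ?D - ?A"
    unfolding vec_eq_iff[where x = "laplacian E ** x"] laplacian_mult_nth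
    by (simp add: sum_subtractf scaleR_conv_of_real)
  then have "norm (laplacian E ** x) \<le> norm ?D + norm ?A"
    by (simp add: norm_triangle_ineq4)
  then show ?thesis using D A by (simp add: d_def)
qed

section \<open>The game and the consensus operator\<close>

lemma convex_minimum_iff_derivative:
  fixes f :: "real \<Rightarrow> real"
  assumes f: "convex_on UNIV f" "(f has_field_derivative D) (at a)"
    and S: "convex S" "a \<in> S"
  shows "(\<forall>t\<in>S. f a \<le> f t) \<longleftrightarrow> (\<forall>t\<in>S. 0 \<le> D * (t - a))"
proof (intro iffI ballI)
  fix t assume min: "\<forall>t\<in>S. f a \<le> f t" and t: "t \<in> S"
  define g where "g s = f (a + s * (t - a))" for s
  have "(g has_field_derivative D * (t - a)) (at 0)"
    unfolding g_def by (rule DERIV_chain'[where f = "\<lambda>s. a + s * (t - a)"])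
      (auto intro!: derivative_eq_intros simp: f(2))
  moreover have "\<exists>s. 0 < s \<and> s < d \<and> g 0 \<le> g s" if "d > 0" for d
  proof (intro exI conjI)
    \<comment> \<open>The bound by \<open>d / 2\<close> keeps the point inside the window that a
      negative derivative would provide; the bound by 1 keeps \<open>a + ?s * (t - a)\<close> a
      convex combination inside \<open>S\<close>.\<close>
    let ?s = "min (d / 2) 1"
    have "a + ?s * (t - a) = (1 - ?s) *\<^sub>R a + ?s *\<^sub>R t"
      by (simp add: algebra_simps)
    moreover have "\<dots> \<in> S"
      using S t that by (intro convexD) auto
    ultimately show "g 0 \<le> g ?s" using min by (simp add: g_def)
  qed (use that in auto)
  ultimately show "0 \<le> D * (t - a)"
    by (metis DERIV_neg_dec_right add_0 not_le)
next
  fix t assume nonneg: "\<forall>t\<in>S. 0 \<le> D * (t - a)" and "t \<in> S"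
  have "D * (t - a) \<le> f t - f a"
    using f by (intro convex_on_imp_above_tangent[where A = UNIV]) auto
  then show "f a \<le> f t" using nonneg \<open>t \<in> S\<close> by fastforce
qed

lemma set_coord_same [simp]: "set_coord x i (x $ i) = x"
  by (simp add: set_coord_def vec_eq_iff)

lemma partial_grad_has_derivative:
  assumes "(\<lambda>t. J i (set_coord x i t)) C1_differentiable_on UNIV"
  shows "((\<lambda>t. J i (set_coord x i t)) has_field_derivative partial_grad J i x) (at (x $ i))"
proof -
  have "(\<lambda>t. J i (set_coord x i t)) differentiable at (x $ i)"
    using assms by (simp add: C1_differentiable_on_eq)
  then show ?thesis
    unfolding partial_grad_def
    by (metis DERIV_imp_deriv real_differentiable_def)
qed

lemma is_nash_iff_variational_inequality:
  assumes "\<And>i. convex (\<Omega> i)"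
    and "\<And>i z. (\<lambda>t. J i (set_coord z i t)) C1_differentiable_on UNIV"
    and "\<And>i z. convex_on UNIV (\<lambda>t. J i (set_coord z i t))"
  shows "is_nash \<Omega> J xs \<longleftrightarrow>
    (\<forall>i. xs $ i \<in> \<Omega> i) \<and> (\<forall>i. \<forall>t\<in>\<Omega> i. 0 \<le> partial_grad J i xs * (t - xs $ i))"
proof -
  have "(\<forall>t\<in>\<Omega> i. J i xs \<le> J i (set_coord xs i t)) \<longleftrightarrow>
      (\<forall>t\<in>\<Omega> i. 0 \<le> partial_grad J i xs * (t - xs $ i))" if "xs $ i \<in> \<Omega> i" for i
    using convex_minimum_iff_derivative[OF assms(3)[of i xs]
        partial_grad_has_derivative[of J i xs, OF assms(2)] assms(1) that] by simp
  then show ?thesis by (auto simp: is_nash_def)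
qed

text \<open>Brouwer's theorem applies to the projected gradient map \<open>f\<close> on the compact
  box \<open>S\<close>. The obtuse-angle property of the projection turns a fixed point into a
  solution of the variational inequality.\<close>

lemma nash_exists:
  fixes \<Omega> :: "'n::finite \<Rightarrow> real set"
  assumes \<Omega>: "\<And>i. \<Omega> i \<noteq> {} \<and> compact (\<Omega> i) \<and> convex (\<Omega> i)"
    and cost: "\<And>i z. (\<lambda>t. J i (set_coord z i t)) C1_differentiable_on UNIV"
      "\<And>i z. convex_on UNIV (\<lambda>t. J i (set_coord z i t))"
    and cont: "continuous_on UNIV (pseudo_grad J)"
  shows "\<exists>xs. is_nash \<Omega> J xs"
proof -
  define S where "S = {x. \<forall>i. x $ i \<in> \<Omega> i}"
  define f where "f x = (\<chi> i. closest_point (\<Omega> i) (x $ i - pseudo_grad J x $ i))" for x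
  have closed: "closed (\<Omega> i)" for i using \<Omega> by (simp add: compact_imp_closed)
  have "closed S"
    unfolding S_def by (intro closed_Collect_all) (auto intro!: closed
        continuous_closed_vimage[of _ "\<lambda>x. x $ _", unfolded vimage_def])
  moreover have "bounded S"
  proof -
    have "bounded (\<Omega> i)" for i using \<Omega> compact_imp_bounded by blast
    then have "\<forall>i. \<exists>b. \<forall>t\<in>\<Omega> i. \<bar>t\<bar> \<le> b" by (simp add: bounded_iff)
    then obtain b where b: "\<And>i t. t \<in> \<Omega> i \<Longrightarrow> \<bar>t\<bar> \<le> b i" by metis
    have "norm x \<le> (\<Sum>i\<in>UNIV. b i)" if "x \<in> S" for x
      using that b by (intro order_trans[OF norm_le_l1_cart] sum_mono) (auto simp: S_def)
    then show ?thesis by (auto simp: bounded_iff)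
  qed
  ultimately have "compact S" by (simp add: compact_eq_bounded_closed)
  moreover have "convex S"
    using \<Omega> by (auto simp: S_def convex_def)
  moreover have "S \<noteq> {}"
  proof -
    have "(\<chi> i. SOME t. t \<in> \<Omega> i) \<in> S" using \<Omega> by (auto simp: S_def some_in_eq)
    then show ?thesis by blast
  qed
  moreover have "continuous_on S f"
  proof -
    have "continuous_on S (\<lambda>x. closest_point (\<Omega> i) (x $ i - pseudo_grad J x $ i))" for i
      using \<Omega> closed
      by (intro continuous_on_compose2[OF continuous_on_closest_point[of "\<Omega> i" UNIV]]
          continuous_intros continuous_on_subset[OF cont]) auto
    then show ?thesis unfolding f_def by (intro continuous_on_vec_lambda)
  qed
  moreover have "f \<in> S \<rightarrow> S"
    using \<Omega> closed by (auto simp: f_def S_def closest_point_in_set)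
  ultimately obtain xs where xs: "xs \<in> S" "f xs = xs" by (rule brouwer)
  have "0 \<le> partial_grad J i xs * (t - xs $ i)" if "t \<in> \<Omega> i" for i t
  proof -
    have "closest_point (\<Omega> i) (xs $ i - pseudo_grad J xs $ i) = xs $ i"
      using arg_cong[OF xs(2), of "\<lambda>y. y $ i"] by (simp add: f_def)
    then show ?thesis
      using closest_point_dot[of "\<Omega> i" t "xs $ i - pseudo_grad J xs $ i"] \<Omega> closed that
      by (simp add: pseudo_grad_def algebra_simps)
  qed
  moreover have "xs $ i \<in> \<Omega> i" for i using xs(1) by (simp add: S_def)
  ultimately show ?thesis
    using is_nash_iff_variational_inequality[of \<Omega> J xs] \<Omega> cost by blast
qed

text \<open>Test the variational inequality of each equilibrium at the other one and add: the inner
  product is at most 0, against strong monotonicity.\<close>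

lemma nash_unique:
  fixes \<Omega> :: "'n::finite \<Rightarrow> real set"
  assumes \<Omega>: "\<And>i. convex (\<Omega> i)"
    and cost: "\<And>i z. (\<lambda>t. J i (set_coord z i t)) C1_differentiable_on UNIV"
      "\<And>i z. convex_on UNIV (\<lambda>t. J i (set_coord z i t))"
    and mono: "\<mu> > 0"
      "\<And>y z. (y - z) \<bullet> (pseudo_grad J y - pseudo_grad J z) \<ge> \<mu> * (norm (y - z))\<^sup>2"
    and nash: "is_nash \<Omega> J y" "is_nash \<Omega> J z"
  shows "y = z"
proof -
  note VI = is_nash_iff_variational_inequality[of \<Omega> J, OF \<Omega> cost]
  have "(y - z) \<bullet> (pseudo_grad J y - pseudo_grad J z) =
      (\<Sum>i\<in>UNIV. - (partial_grad J i y * (z $ i - y $ i)) - partial_grad J i z * (y $ i - z $ i))"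
    by (simp add: inner_vec_def pseudo_grad_def algebra_simps)
  also have "\<dots> \<le> 0"
    using nash unfolding VI by (intro sum_nonpos) (smt (verit))
  finally have "\<mu> * (norm (y - z))\<^sup>2 \<le> 0" using mono(2)[of y z] by linarith
  then show ?thesis using mono(1) by (simp add: mult_le_0_iff)
qed

section \<open>Consensus vectors and the consensus operator\<close>

text \<open>This is the Kronecker product of the all-ones vector with \<open>y\<close>; these
  vectors form the consensus subspace.\<close>

definition replicate_rows :: "real ^ 'm \<Rightarrow> real ^ 'm ^ 'n" where
  "replicate_rows y = (\<chi> i. y)"

definition own_coords :: "real ^ 'n ^ 'n \<Rightarrow> real ^ 'n" where
  "own_coords x = (\<chi> i. x $ i $ i)"

text \<open>The adjoint of \<open>own_coords\<close>, see \<open>inner_embed_own\<close>; it lifts a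
  pseudo-gradient to the stacked space.\<close>

definition embed_own :: "real ^ 'n \<Rightarrow> real ^ 'n ^ 'n" where
  "embed_own f = (\<chi> i l. if l = i then f $ i else 0)"

lemma inner_embed_own: "x \<bullet> embed_own f = own_coords x \<bullet> f"
  by (simp add: inner_vec_def embed_own_def own_coords_def if_distrib[of "\<lambda>t. _ * t"] cong: if_cong)

lemma norm_own_coords_le: "norm (own_coords x) \<le> norm x"
proof (rule power2_le_imp_le)
  have "(x $ i $ i)\<^sup>2 \<le> (norm (x $ i))\<^sup>2" for i
    using component_le_norm_cart[of "x $ i" i] by (metis abs_ge_zero power2_abs power_mono)
  then show "(norm (own_coords x))\<^sup>2 \<le> (norm x)\<^sup>2"
    unfolding power2_norm_eq_inner own_coords_def inner_vec_def[of "_ :: real ^ _"]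
      inner_vec_def[of "_ :: real ^ _ ^ _"]
    by (intro sum_mono) (simp add: power2_norm_eq_inner[symmetric] power2_eq_square)
qed simp

lemma norm_embed_own: "norm (embed_own f) = norm f"
  by (simp add: norm_eq_sqrt_inner inner_embed_own) (simp add: own_coords_def embed_own_def)

lemma ext_pseudo_grad_replicate: "ext_pseudo_grad J (replicate_rows y) = pseudo_grad J y"
  by (simp add: ext_pseudo_grad_def pseudo_grad_def replicate_rows_def)

lemma norm_replicate: "(norm (replicate_rows y :: real ^ 'm ^ 'n))\<^sup>2 = CARD('n) * (norm y)\<^sup>2"
  unfolding power2_norm_eq_inner replicate_rows_def by (subst inner_vec_def) simp

lemma replicate_rows_diff: "replicate_rows y - replicate_rows z = replicate_rows (y - z)"
  by (simp add: replicate_rows_def vec_eq_iff)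

text \<open>Only the share \<open>c\<^sub>0\<close> of the consensus weight enters here, as the
  penalty that compensates for missing monotonicity off consensus. The share \<open>c\<close> goes
  into the dual variable and \<open>step_matrix\<close>.\<close>

definition consensus_operator ::
    "('n \<Rightarrow> real ^ 'n \<Rightarrow> real) \<Rightarrow> ('n::finite \<times> 'n) set \<Rightarrow> real \<Rightarrow> real ^ 'n ^ 'n \<Rightarrow> real ^ 'n ^ 'n" where
  "consensus_operator J E c\<^sub>0 x = embed_own (ext_pseudo_grad J x) + c\<^sub>0 *\<^sub>R (laplacian E ** x)"

lemma embed_own_diff: "embed_own f - embed_own g = embed_own (f - g)"
  by (simp add: embed_own_def vec_eq_iff)

lemma matrix_mult_diff_right: "A ** (x - y) = A ** x - A ** y" for A :: "real ^ 'n ^ 'k"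
  by (simp add: matrix_matrix_mult_def vec_eq_iff right_diff_distrib sum_subtractf)

lemma consensus_operator_diff:
  "consensus_operator J E c\<^sub>0 x - consensus_operator J E c\<^sub>0 y =
     embed_own (ext_pseudo_grad J x - ext_pseudo_grad J y) + c\<^sub>0 *\<^sub>R (laplacian E ** (x - y))"
  by (simp add: consensus_operator_def embed_own_diff[symmetric] matrix_mult_diff_right algebra_simps)

lemma consensus_operator_lipschitz:
  assumes "sym E" "c\<^sub>0 \<ge> 0"
    and "\<And>y z. norm (ext_pseudo_grad J y - ext_pseudo_grad J z) \<le> \<theta> * norm (y - z)"
  shows "norm (consensus_operator J E c\<^sub>0 x - consensus_operator J E c\<^sub>0 y)
    \<le> (\<theta> + 2 * c\<^sub>0 * max_degree E) * norm (x - y)"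
proof -
  have "norm (consensus_operator J E c\<^sub>0 x - consensus_operator J E c\<^sub>0 y)
      \<le> norm (ext_pseudo_grad J x - ext_pseudo_grad J y) + c\<^sub>0 * norm (laplacian E ** (x - y))"
    unfolding consensus_operator_diff using assms(2)
    by (intro order_trans[OF norm_triangle_ineq]) (simp add: norm_embed_own)
  also have "\<dots> \<le> \<theta> * norm (x - y) + c\<^sub>0 * (2 * max_degree E * norm (x - y))"
    using assms by (intro add_mono mult_left_mono laplacian_norm_bound) auto
  finally show ?thesis by (simp add: algebra_simps)
qed

text \<open>Monotonicity is assumed only for \<open>pseudo_grad\<close>, that is, on the consensus
  subspace. The error splits orthogonally into a consensus part, controlled by strong monotonicity,
  and a disagreement part, controlled by the Laplacian. Lipschitz bounds on the cross terms give the
  quadratic form of \<open>Psi_matrix\<close>.\<close>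

lemma consensus_operator_restricted_monotone:
  fixes E :: "('n::finite \<times> 'n) set"
  assumes E: "sym E" "connected_graph E" and card: "CARD('n) \<ge> 2" and c0: "c\<^sub>0 \<ge> 0"
    and mono: "\<And>y z. (y - z) \<bullet> (pseudo_grad J y - pseudo_grad J z) \<ge> \<mu> * (norm (y - z))\<^sup>2"
    and lip: "\<And>y z. norm (pseudo_grad J y - pseudo_grad J z) \<le> \<theta>\<^sub>0 * norm (y - z)"
    and ext_lip: "\<And>y z. norm (ext_pseudo_grad J y - ext_pseudo_grad J z) \<le> \<theta> * norm (y - z)"
  shows "lambda_min (Psi_matrix CARD('n) \<mu> \<theta> \<theta>\<^sub>0 c\<^sub>0 (lambda_2 (laplacian E)))
      * (norm (x - replicate_rows xs))\<^sup>2
    \<le> (x - replicate_rows xs) \<bullet>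
      (consensus_operator J E c\<^sub>0 x - consensus_operator J E c\<^sub>0 (replicate_rows xs))"
proof -
  define y where "y = (1 / CARD('n)) *\<^sub>R (\<Sum>i\<in>UNIV. x $ i)"
  define z where "z = x - replicate_rows y"
  define d where "d = y - xs"
  define F where "F = ext_pseudo_grad J"
  \<comment> \<open>These are the norms of the two orthogonal parts of the error;
    \<open>sqrt CARD('n)\<close> is the norm of replication and explains the scaling in
    \<open>Psi_matrix\<close>.\<close>
  define a b where "a = sqrt CARD('n) * norm d" and "b = norm z"
  have N: "CARD('n) > 0" by simp
  have z_sum: "(\<Sum>i\<in>UNIV. z $ i) = 0"
    using N by (simp add: z_def y_def replicate_rows_def sum_subtractf sum_constant_scaleR
        del: sum_constant)
  have e: "x - replicate_rows xs = replicate_rows d + z"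
    by (simp add: z_def d_def replicate_rows_diff[symmetric])
  have a2: "a\<^sup>2 = (norm (replicate_rows d :: real ^ 'n ^ 'n))\<^sup>2"
    by (simp add: a_def norm_replicate power_mult_distrib)
  have "(replicate_rows d :: real ^ 'n ^ 'n) \<bullet> z = d \<bullet> (\<Sum>i\<in>UNIV. z $ i)"
    by (simp add: inner_vec_def[of "replicate_rows d"] inner_sum_right) (simp add: replicate_rows_def)
  then have "(replicate_rows d :: real ^ 'n ^ 'n) \<bullet> z = 0" using z_sum by simp
  then have norm_e: "(norm (x - replicate_rows xs))\<^sup>2 = a\<^sup>2 + b\<^sup>2"
    unfolding e a2 b_def by (intro norm_add_Pythagorean) (simp add: orthogonal_def)
  have own: "own_coords (x - replicate_rows xs) = d + own_coords z"
    unfolding e by (simp add: own_coords_def replicate_rows_def vec_eq_iff)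
  have own_z: "norm (own_coords z) \<le> b" by (simp add: b_def norm_own_coords_le)
  have F1: "norm (F x - pseudo_grad J y) \<le> \<theta> * b"
    using ext_lip[of x "replicate_rows y"] by (simp add: F_def b_def z_def ext_pseudo_grad_replicate)
  have F2: "norm (pseudo_grad J y - pseudo_grad J xs) \<le> \<theta>\<^sub>0 * norm d"
    using lip[of y xs] by (simp add: d_def)
  have cs: "- (p * q) \<le> u \<bullet> v" if "norm u \<le> p" "norm v \<le> q" for u v :: "real ^ 'n" and p q
  proof -
    have "norm u * norm v \<le> p * q"
      using that by (intro mult_mono) (auto intro: order_trans[OF norm_ge_zero])
    then show ?thesis using Cauchy_Schwarz_ineq2[of u v] by linarith
  qed
  \<comment> \<open>Inserting \<open>pseudo_grad J y\<close> at the average \<open>y\<close>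
    separates the disagreement effect \<open>F1\<close> from the consensus effect. Of the four
    products, one uses strong monotonicity and three use Cauchy-Schwarz.\<close>
  have "(x - replicate_rows xs) \<bullet> embed_own (F x - F (replicate_rows xs)) =
      (d + own_coords z) \<bullet> ((F x - pseudo_grad J y) + (pseudo_grad J y - pseudo_grad J xs))"
    by (simp add: inner_embed_own own F_def ext_pseudo_grad_replicate)
  also have "\<dots> = d \<bullet> (F x - pseudo_grad J y) + d \<bullet> (pseudo_grad J y - pseudo_grad J xs)
      + own_coords z \<bullet> (F x - pseudo_grad J y) + own_coords z \<bullet> (pseudo_grad J y - pseudo_grad J xs)"
    by (simp only: inner_add_left inner_add_right)
  also have "\<dots> \<ge> - (norm d * (\<theta> * b)) + \<mu> * (norm d)\<^sup>2 - b * (\<theta> * b) - b * (\<theta>\<^sub>0 * norm d)"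
    using cs[OF order_refl F1, of d] cs[OF own_z F1] cs[OF own_z F2] mono[of y xs]
    unfolding d_def[symmetric] by linarith
  finally have grad: "\<mu> * (norm d)\<^sup>2 - (\<theta> + \<theta>\<^sub>0) * norm d * b - \<theta> * b\<^sup>2
      \<le> (x - replicate_rows xs) \<bullet> embed_own (F x - F (replicate_rows xs))"
    by (simp add: power2_eq_square algebra_simps)
  have sym: "transpose (laplacian E) = laplacian E" by (rule transpose_laplacian[OF E(1)])
  have Le: "laplacian E ** (x - replicate_rows xs) = laplacian E ** z"
    unfolding e by (simp add: matrix_add_ldistrib replicate_rows_def laplacian_mult_replicated)
  \<comment> \<open>The Laplacian annihilates the consensus part on the right, and by symmetry also
    on the left.\<close>
  have "(x - replicate_rows xs) \<bullet> (laplacian E ** (x - replicate_rows xs)) = z \<bullet> (laplacian E ** z)"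
    unfolding Le using inner_symmetric_matrix_mult[OF sym] by (metis Le)
  also have "\<dots> \<ge> lambda_2 (laplacian E) * b\<^sup>2"
    unfolding b_def by (rule lambda_2_rayleigh_stacked[OF E card z_sum])
  finally have lap: "lambda_2 (laplacian E) * b\<^sup>2
      \<le> (x - replicate_rows xs) \<bullet> (laplacian E ** (x - replicate_rows xs))" .
  have "lambda_min (Psi_matrix CARD('n) \<mu> \<theta> \<theta>\<^sub>0 c\<^sub>0 (lambda_2 (laplacian E))) * (a\<^sup>2 + b\<^sup>2)
      \<le> \<mu> / CARD('n) * a\<^sup>2 - (\<theta> + \<theta>\<^sub>0) / sqrt CARD('n) * a * b
        + (c\<^sub>0 * lambda_2 (laplacian E) - \<theta>) * b\<^sup>2"
    by (rule Psi_matrix_quadratic_form)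
  also have "\<dots> = (\<mu> * (norm d)\<^sup>2 - (\<theta> + \<theta>\<^sub>0) * norm d * b - \<theta> * b\<^sup>2)
      + c\<^sub>0 * (lambda_2 (laplacian E) * b\<^sup>2)"
    using N by (simp add: a_def power_mult_distrib field_simps)
  also have "\<dots> \<le> (x - replicate_rows xs) \<bullet> embed_own (F x - F (replicate_rows xs))
      + c\<^sub>0 * ((x - replicate_rows xs) \<bullet> (laplacian E ** (x - replicate_rows xs)))"
    by (intro add_mono grad mult_left_mono lap c0)
  finally show ?thesis
    unfolding norm_e consensus_operator_diff by (simp add: F_def inner_add_right)
qed

section \<open>Convergence of the algorithm\<close>

text \<open>The term \<open>- c *\<^sub>R laplacian E\<close> arises when the dual variable used by
  the algorithm is replaced by its next value.\<close>

definition step_matrix :: "('n::finite \<times> 'n) set \<Rightarrow> real \<Rightarrow> real \<Rightarrow> ('n \<Rightarrow> real) \<Rightarrow> real ^ 'n ^ 'n" where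
  "step_matrix E c c\<^sub>0 \<beta> =
     diag_matrix \<beta> + (2 * (c + c\<^sub>0)) *\<^sub>R degree_matrix E - c *\<^sub>R laplacian E"

lemma transpose_step_matrix:
  assumes "sym E"
  shows "transpose (step_matrix E c c\<^sub>0 \<beta>) = step_matrix E c c\<^sub>0 \<beta>"
proof -
  have "laplacian E $ i $ j = laplacian E $ j $ i" for i j
    using arg_cong[OF transpose_laplacian[OF assms], of "\<lambda>A. A $ j $ i"] by (simp add: transpose_def)
  then show ?thesis
    by (simp add: step_matrix_def transpose_def vec_eq_iff degree_matrix_def diag_matrix_def)
qed

lemma step_matrix_mult_nth:
  fixes x :: "real ^ 'm ^ 'n"
  shows "(step_matrix E c c\<^sub>0 \<beta> ** x) $ i $ l =
    (\<beta> i + 2 * (c + c\<^sub>0) * card (nbrs E i)) * x $ i $ l - c * (laplacian E ** x) $ i $ l"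
proof -
  have "step_matrix E c c\<^sub>0 \<beta> $ i $ j =
      diag_matrix (\<lambda>i. \<beta> i + 2 * (c + c\<^sub>0) * card (nbrs E i)) $ i $ j - c * laplacian E $ i $ j" for j
    by (simp add: step_matrix_def degree_matrix_def diag_matrix_def)
  then have "(step_matrix E c c\<^sub>0 \<beta> ** x) $ i $ l =
      (diag_matrix (\<lambda>i. \<beta> i + 2 * (c + c\<^sub>0) * card (nbrs E i)) ** x) $ i $ l
      - c * (laplacian E ** x) $ i $ l"
    by (simp add: matrix_matrix_mult_def left_diff_distrib sum_subtractf sum_distrib_left mult.assoc)
  then show ?thesis by (simp add: diag_matrix_mult_nth)
qed

lemma symmetric_polarization:
  fixes A :: "real ^ 'n ^ 'n" and x y :: "real ^ 'm ^ 'n"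
  assumes "transpose A = A"
  shows "x \<bullet> (A ** (x - y)) = (x \<bullet> (A ** x) - y \<bullet> (A ** y) + (x - y) \<bullet> (A ** (x - y))) / 2"
  using inner_symmetric_matrix_mult[OF assms, of x y]
  by (simp add: matrix_mult_diff_right inner_diff_left inner_diff_right)

text \<open>\<open>r k\<close> is the residual of one step written with
  \<open>w (Suc (Suc k))\<close>, because \<open>w (Suc k)\<close> equals it minus \<open>c\<close>
  times the Laplacian of \<open>x (Suc k)\<close>. The unprojected coordinates leave no residual;
  the projected ones leave a normal-cone element.\<close>

lemma algorithm_run_step:
  fixes \<Omega> :: "'n::finite \<Rightarrow> real set"
  assumes run: "algorithm_run \<Omega> J E c c\<^sub>0 \<beta> x w"
    and \<Omega>: "\<And>i. \<Omega> i \<noteq> {} \<and> closed (\<Omega> i) \<and> convex (\<Omega> i)"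
    and pos: "\<And>i. \<beta> i > 0" "c + c\<^sub>0 \<ge> 0"
  defines "r k \<equiv> step_matrix E c c\<^sub>0 \<beta> ** (x (Suc k) - x k) + consensus_operator J E c\<^sub>0 (x k)
    + w (Suc (Suc k))"
  shows "x (Suc k) $ i $ i \<in> \<Omega> i"
    and "l \<noteq> i \<Longrightarrow> r k $ i $ l = 0"
    and "t \<in> \<Omega> i \<Longrightarrow> (x (Suc k) $ i $ i - t) * r k $ i $ i \<le> 0"
proof -
  define cb where "cb = c + c\<^sub>0"
  define \<alpha> where "\<alpha> i = \<beta> i + 2 * cb * card (nbrs E i)" for i
  define g where "g i l = embed_own (ext_pseudo_grad J (x k)) $ i $ l" for i l
  \<comment> \<open>The point before projection. Since \<open>g\<close> vanishes off the own
    coordinate, one formula covers both update rules.\<close>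
  define p where "p i l = inverse (\<alpha> i) * (- g i l - w (Suc k) $ i $ l + \<beta> i * x k $ i $ l
      + cb * (\<Sum>j\<in>nbrs E i. x k $ i $ l + x k $ j $ l))" for i l
  have \<alpha>: "\<alpha> i > 0" for i
    using pos by (auto simp: \<alpha>_def cb_def intro!: add_pos_nonneg)
  have w: "w (Suc k) $ i = w k $ i + c *\<^sub>R (\<Sum>j\<in>nbrs E i. x k $ i - x k $ j)" for k i
    using run by (simp add: algorithm_run_def Let_def)
  have own: "x (Suc k) $ i $ i = closest_point (\<Omega> i) (p i i)"
    using run by (simp add: algorithm_run_def Let_def p_def g_def \<alpha>_def cb_def embed_own_def
        ext_pseudo_grad_def)
  have other: "x (Suc k) $ i $ l = p i l" if "l \<noteq> i" for l
  proof -
    have "x (Suc k) $ i $ l = inverse (\<alpha> i) * (\<beta> i * x k $ i $ l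
        + cb * (\<Sum>j\<in>nbrs E i. x k $ i $ l + x k $ j $ l) - w (Suc k) $ i $ l)"
      using run that by (simp add: algorithm_run_def Let_def \<alpha>_def cb_def)
    moreover have "g i l = 0" using that by (simp add: g_def embed_own_def)
    ultimately show ?thesis by (simp add: p_def algebra_simps)
  qed
  have r: "r k $ i $ l = \<alpha> i * (x (Suc k) $ i $ l - p i l)" for l
  proof -
    have lap: "(laplacian E ** x k) $ i $ l =
        card (nbrs E i) * x k $ i $ l - (\<Sum>j\<in>nbrs E i. x k $ j $ l)" for k
      unfolding laplacian_mult_nth sum_component vector_minus_component sum_subtractf by simp
    have "\<alpha> i * p i l = - g i l - w (Suc k) $ i $ l + \<beta> i * x k $ i $ l
        + cb * (2 * card (nbrs E i) * x k $ i $ l - (laplacian E ** x k) $ i $ l)"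
      using \<alpha>[of i] by (simp add: p_def lap sum.distrib)
    moreover have "w (Suc (Suc k)) $ i $ l = w (Suc k) $ i $ l + c * (laplacian E ** x (Suc k)) $ i $ l"
      unfolding w[of "Suc k"] laplacian_mult_nth by simp
    ultimately show ?thesis
      unfolding r_def
      by (simp add: step_matrix_mult_nth consensus_operator_def g_def[symmetric] matrix_mult_diff_right
          \<alpha>_def cb_def algebra_simps)
  qed
  show "x (Suc k) $ i $ i \<in> \<Omega> i"
    unfolding own using \<Omega> by (intro closest_point_in_set) auto
  show "r k $ i $ l = 0" if "l \<noteq> i" using r other that by simp
  show "(x (Suc k) $ i $ i - t) * r k $ i $ i \<le> 0" if "t \<in> \<Omega> i"
  proof -
    have "(p i i - x (Suc k) $ i $ i) * (t - x (Suc k) $ i $ i) \<le> 0"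
      using closest_point_dot[of "\<Omega> i" t "p i i"] \<Omega> that by (simp add: own)
    then have "\<alpha> i * ((p i i - x (Suc k) $ i $ i) * (t - x (Suc k) $ i $ i)) \<le> 0"
      using \<alpha>[of i] by (simp add: mult_le_0_iff)
    then show ?thesis unfolding r by (simp add: algebra_simps)
  qed
qed

text \<open>Telescoping bounds the partial sums of \<open>a\<close> by
  \<open>V 0 / \<epsilon>\<close>, so \<open>a\<close> is summable.\<close>

lemma descent_tendsto_zero:
  fixes V a :: "nat \<Rightarrow> real"
  assumes "\<epsilon> > 0" "\<And>k. 0 \<le> V k" "\<And>k. 0 \<le> a k" "\<And>k. V (Suc k) + \<epsilon> * a k \<le> V k"
  shows "a \<longlonglongrightarrow> 0"
proof -
  have "\<epsilon> * (\<Sum>k<n. a k) + V n \<le> V 0" for n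
  proof (induction n)
    case (Suc n)
    then show ?case using assms(4)[of n] by (simp add: distrib_left)
  qed simp
  then have "(\<Sum>k<n. a k) \<le> V 0 / \<epsilon>" for n
    using assms(1,2) by (smt (verit) pos_le_divide_eq mult.commute)
  then have "summable a" by (intro summableI_nonneg_bounded assms(3))
  then show ?thesis by (rule summable_LIMSEQ_zero)
qed

text \<open>The constants \<open>m\<close> and \<open>q\<close> stand for \<open>\<mu>_bar\<close>
  and \<open>\<theta>_bar\<close>. Monotonicity is required only relative to the equilibrium point,
  as the restricted estimate provides.\<close>

lemma algorithm_converges:
  fixes \<Omega> :: "'n::finite \<Rightarrow> real set" and E :: "('n \<times> 'n) set" and x :: "nat \<Rightarrow> real ^ 'n ^ 'n"
  assumes run: "algorithm_run \<Omega> J E c c\<^sub>0 \<beta> x w"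
    and \<Omega>: "\<And>i. \<Omega> i \<noteq> {} \<and> closed (\<Omega> i) \<and> convex (\<Omega> i)"
    and E: "sym E" and pos: "\<And>i. \<beta> i > 0" "c \<ge> 0" "c\<^sub>0 \<ge> 0" "m > 0"
    and VI: "\<And>i. xs $ i \<in> \<Omega> i" "\<And>i t. t \<in> \<Omega> i \<Longrightarrow> 0 \<le> partial_grad J i xs * (t - xs $ i)"
    and mono: "\<And>y. m * (norm (y - replicate_rows xs))\<^sup>2 \<le> (y - replicate_rows xs) \<bullet>
      (consensus_operator J E c\<^sub>0 y - consensus_operator J E c\<^sub>0 (replicate_rows xs))"
    and lip: "\<And>y z. norm (consensus_operator J E c\<^sub>0 y - consensus_operator J E c\<^sub>0 z)
      \<le> q * norm (y - z)"
    and step: "q\<^sup>2 / (2 * m) < lambda_min (step_matrix E c c\<^sub>0 \<beta>)"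
  shows "x \<longlonglongrightarrow> replicate_rows xs"
proof -
  let ?L = "laplacian E" and ?\<Phi> = "step_matrix E c c\<^sub>0 \<beta>" and ?T = "consensus_operator J E c\<^sub>0"
  define xb :: "real ^ 'n ^ 'n" where "xb = replicate_rows xs"
  define e u where "e k = x k - xb" and "u k = (\<Sum>s\<le>k. e s)" for k
  define \<eta> where "\<eta> = lambda_min ?\<Phi>"
  define V where "V k = e k \<bullet> (?\<Phi> ** e k) + c * (u k \<bullet> (?L ** u k))" for k
  note symL = transpose_laplacian[OF E] and sym\<Phi> = transpose_step_matrix[OF E, of c c\<^sub>0 \<beta>]
  have \<eta>: "\<eta> > 0" "q\<^sup>2 < 2 * m * \<eta>"
  proof -
    have "0 \<le> q\<^sup>2 / (2 * m)" using pos(4) by simp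
    then show "\<eta> > 0" using step unfolding \<eta>_def by linarith
    show "q\<^sup>2 < 2 * m * \<eta>" using step pos(4) by (simp add: \<eta>_def field_simps)
  qed
  have Lxb: "?L ** xb = 0" by (simp add: xb_def replicate_rows_def laplacian_mult_replicated)
  have Le: "?L ** e k = ?L ** x k" for k by (simp add: e_def matrix_mult_diff_right Lxb)
  \<comment> \<open>The dual update reads the previous iterate, so \<open>w (Suc k)\<close> has
    accumulated \<open>x 0\<close> to \<open>x k\<close>. Replacing \<open>x\<close> by
    \<open>e\<close> is free because the Laplacian annihilates \<open>xb\<close>.\<close>
  have w: "w (Suc k) = c *\<^sub>R (?L ** u k)" for k
  proof -
    have w0: "w 0 = 0" using run by (simp add: algorithm_run_def Let_def vec_eq_iff)
    have wSuc: "w (Suc k) = w k + c *\<^sub>R (?L ** x k)" for k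
      using run unfolding algorithm_run_def Let_def
      by (simp add: vec_eq_iff[where x = "w (Suc k)"] laplacian_mult_nth)
    show ?thesis
    proof (induction k)
      case 0
      then show ?case using wSuc[of 0] by (simp add: w0 u_def Le)
    next
      case (Suc k)
      then show ?case using wSuc[of "Suc k"]
        by (simp add: u_def matrix_add_ldistrib Le scaleR_add_right)
    qed
  qed
  have V_nonneg: "0 \<le> V k" for k
  proof -
    have "0 \<le> \<eta> * (norm (e k))\<^sup>2" using \<eta>(1) by simp
    also have "\<dots> \<le> e k \<bullet> (?\<Phi> ** e k)"
      unfolding \<eta>_def by (rule lambda_min_rayleigh_stacked[OF sym\<Phi>])
    finally show ?thesis
      unfolding V_def using laplacian_nonneg_stacked[OF E, of "u k"] pos(2) by simp
  qed
  have descent: "V (Suc k) + (2 * m - q\<^sup>2 / \<eta>) * (norm (e k))\<^sup>2 \<le> V k" for k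
  proof -
    define d where "d = e (Suc k) - e k"
    define r where "r = ?\<Phi> ** (x (Suc k) - x k) + ?T (x k) + w (Suc (Suc k))"
    have "c + c\<^sub>0 \<ge> 0" using pos by simp
    note res = algorithm_run_step[OF run \<Omega> pos(1) this, where k = k, folded r_def]
    have "r = embed_own (own_coords r)"
      using res(2) by (simp add: embed_own_def own_coords_def vec_eq_iff)
    then have "e (Suc k) \<bullet> r = own_coords (e (Suc k)) \<bullet> own_coords r"
      by (metis inner_embed_own)
    also have "\<dots> = (\<Sum>i\<in>UNIV. (x (Suc k) $ i $ i - xs $ i) * r $ i $ i)"
      by (simp add: inner_vec_def own_coords_def e_def xb_def replicate_rows_def)
    also have "\<dots> \<le> 0" by (intro sum_nonpos res(3) VI(1))
    finally have r_le: "e (Suc k) \<bullet> r \<le> 0" .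
    have "?T xb = embed_own (pseudo_grad J xs)"
      by (simp add: consensus_operator_def Lxb) (simp add: xb_def ext_pseudo_grad_replicate)
    \<comment> \<open>The own coordinates of the new iterate lie in the action sets, so they are
      admissible test points in the variational inequality of \<open>xs\<close>.\<close>
    then have "e (Suc k) \<bullet> ?T xb = (\<Sum>i\<in>UNIV. partial_grad J i xs * (x (Suc k) $ i $ i - xs $ i))"
      by (simp add: inner_embed_own) (simp add: inner_vec_def own_coords_def pseudo_grad_def e_def
          xb_def replicate_rows_def mult.commute)
    also have "\<dots> \<ge> 0" by (intro sum_nonneg VI(2) res(1))
    finally have T_ge: "0 \<le> e (Suc k) \<bullet> ?T xb" .
    have "r = ?\<Phi> ** d + ?T (x k) + c *\<^sub>R (?L ** u (Suc k))"
      by (simp add: r_def d_def e_def w)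
    then have ineq: "e (Suc k) \<bullet> (?\<Phi> ** d) + e (Suc k) \<bullet> (?T (x k) - ?T xb)
        + c * (e (Suc k) \<bullet> (?L ** u (Suc k))) \<le> 0"
      using r_le T_ge by (simp add: inner_add_right inner_diff_right)
    have "e (Suc k) \<bullet> (?\<Phi> ** d) =
        (e (Suc k) \<bullet> (?\<Phi> ** e (Suc k)) - e k \<bullet> (?\<Phi> ** e k) + d \<bullet> (?\<Phi> ** d)) / 2"
      unfolding d_def by (rule symmetric_polarization[OF sym\<Phi>])
    moreover have "\<eta> * (norm d)\<^sup>2 \<le> d \<bullet> (?\<Phi> ** d)"
      unfolding \<eta>_def by (rule lambda_min_rayleigh_stacked[OF sym\<Phi>])
    ultimately have primal: "e (Suc k) \<bullet> (?\<Phi> ** e (Suc k)) - e k \<bullet> (?\<Phi> ** e k) + \<eta> * (norm d)\<^sup>2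
        \<le> 2 * (e (Suc k) \<bullet> (?\<Phi> ** d))" by simp
    have eu: "e (Suc k) = u (Suc k) - u k" by (simp add: u_def)
    \<comment> \<open>Since \<open>e (Suc k)\<close> is the increment of \<open>u\<close>,
      polarization telescopes the dual form; the leftover square is nonnegative and is
      dropped.\<close>
    have "e (Suc k) \<bullet> (?L ** u (Suc k)) = (u (Suc k) \<bullet> (?L ** u (Suc k)) - u k \<bullet> (?L ** u k)
        + e (Suc k) \<bullet> (?L ** e (Suc k))) / 2"
      using symmetric_polarization[OF symL, of "u (Suc k)" "u k", folded eu]
      unfolding inner_symmetric_matrix_mult[OF symL, of "e (Suc k)" "u (Suc k)"] .
    then have "u (Suc k) \<bullet> (?L ** u (Suc k)) - u k \<bullet> (?L ** u k)
        \<le> 2 * (e (Suc k) \<bullet> (?L ** u (Suc k)))"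
      using laplacian_nonneg_stacked[OF E, of "e (Suc k)"] by simp
    then have dual: "c * (u (Suc k) \<bullet> (?L ** u (Suc k))) - c * (u k \<bullet> (?L ** u k))
        \<le> 2 * (c * (e (Suc k) \<bullet> (?L ** u (Suc k))))"
      using mult_left_mono[OF _ pos(2)] by (fastforce simp: algebra_simps)
    have "m * (norm (e k))\<^sup>2 \<le> e k \<bullet> (?T (x k) - ?T xb)"
      unfolding e_def xb_def by (rule mono)
    moreover have "- (q * norm (e k) * norm d) \<le> d \<bullet> (?T (x k) - ?T xb)"
    proof -
      have "\<bar>d \<bullet> (?T (x k) - ?T xb)\<bar> \<le> norm d * (q * norm (e k))"
        unfolding e_def
        by (intro order_trans[OF Cauchy_Schwarz_ineq2] mult_left_mono lip) auto
      then show ?thesis by (simp add: algebra_simps abs_le_iff)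
    qed
    \<comment> \<open>The operator is evaluated at the old iterate but tested against the new error.
      The old error gives monotonicity, and the increment \<open>d\<close> costs a Lipschitz
      term.\<close>
    moreover have "e (Suc k) \<bullet> (?T (x k) - ?T xb) =
        e k \<bullet> (?T (x k) - ?T xb) + d \<bullet> (?T (x k) - ?T xb)"
      by (simp add: d_def inner_diff_left)
    ultimately have grad: "m * (norm (e k))\<^sup>2 - q * norm (e k) * norm d
        \<le> e (Suc k) \<bullet> (?T (x k) - ?T xb)" by linarith
    \<comment> \<open>Young's inequality: the cross term is absorbed by
      \<open>\<eta> * (norm d)\<^sup>2\<close> from \<open>primal\<close>, at the price of
      \<open>q\<^sup>2 / \<eta> * (norm (e k))\<^sup>2\<close>.\<close>
    have "0 \<le> \<eta> * (norm d - q / \<eta> * norm (e k))\<^sup>2" using \<eta>(1) by simp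
    also have "\<dots> = \<eta> * (norm d)\<^sup>2 - 2 * (q * norm (e k) * norm d) + q\<^sup>2 / \<eta> * (norm (e k))\<^sup>2"
      using \<eta>(1) by (simp add: field_simps power2_eq_square)
    finally have "2 * (m * (norm (e k))\<^sup>2) - q\<^sup>2 / \<eta> * (norm (e k))\<^sup>2
        \<le> 2 * (m * (norm (e k))\<^sup>2) - 2 * (q * norm (e k) * norm d) + \<eta> * (norm d)\<^sup>2" by simp
    then show ?thesis
      using ineq primal dual grad unfolding V_def left_diff_distrib by linarith
  qed
  \<comment> \<open>The step-size condition is precisely the positivity of this descent
    coefficient.\<close>
  have "2 * m - q\<^sup>2 / \<eta> > 0" using \<eta> by (simp add: field_simps)
  then have "(\<lambda>k. (norm (e k))\<^sup>2) \<longlonglongrightarrow> 0"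
    by (rule descent_tendsto_zero[where V = V]) (rule V_nonneg zero_le_power2 descent)+
  then have "(\<lambda>k. norm (e k)) \<longlonglongrightarrow> 0"
    using tendsto_real_sqrt[of "\<lambda>k. (norm (e k))\<^sup>2" 0 sequentially] by simp
  then show ?thesis
    unfolding e_def xb_def by (simp add: LIM_zero_iff tendsto_norm_zero_iff)
qed

theorem theorem1:
  fixes \<Omega> :: "'n::finite \<Rightarrow> real set"
    and J :: "'n \<Rightarrow> real ^ 'n \<Rightarrow> real"
    and E :: "('n \<times> 'n) set"
    and \<mu> \<theta>\<^sub>0 \<theta> c c\<^sub>0 c_min \<mu>_bar \<theta>_bar :: real
    and \<beta> :: "'n \<Rightarrow> real"
    and x w :: "nat \<Rightarrow> real ^ 'n ^ 'n"
  assumes action_sets: "\<And>i. \<Omega> i \<noteq> {} \<and> compact (\<Omega> i) \<and> convex (\<Omega> i)"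
    and cost_C1: "\<And>i z. (\<lambda>t. J i (set_coord z i t)) C1_differentiable_on UNIV"
    and cost_convex: "\<And>i z. convex_on UNIV (\<lambda>t. J i (set_coord z i t))"
    and cost_cont: "\<And>i. continuous_on UNIV (J i)"
    and mu_pos: "\<mu> > 0"
    and theta0_pos: "\<theta>\<^sub>0 > 0"
    and strong_mono:
      "\<And>y z. (y - z) \<bullet> (pseudo_grad J y - pseudo_grad J z) \<ge> \<mu> * (norm (y - z))\<^sup>2"
    and pseudo_lipschitz:
      "\<And>y z. norm (pseudo_grad J y - pseudo_grad J z) \<le> \<theta>\<^sub>0 * norm (y - z)"
    and undirected: "sym E" "irrefl E"
    and graph_connected: "connected_graph E"
    and no_isolated: "\<And>i. nbrs E i \<noteq> {}"
    and theta_pos: "\<theta> > 0"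
    and ext_lipschitz:
      "\<And>y z. norm (ext_pseudo_grad J y - ext_pseudo_grad J z) \<le> \<theta> * norm (y - z)"
    and c_pos: "c > 0"
    and c_min: "c_min * lambda_2 (laplacian E) = (\<theta> + \<theta>\<^sub>0)\<^sup>2 / (4 * \<mu>) + \<theta>"
    and c0_gt: "c\<^sub>0 > c_min"
    and mu_bar:
      "\<mu>_bar = lambda_min (Psi_matrix CARD('n) \<mu> \<theta> \<theta>\<^sub>0 c\<^sub>0 (lambda_2 (laplacian E)))"
    and theta_bar: "\<theta>_bar = \<theta> + 2 * c\<^sub>0 * real (max_degree E)"
    and beta_pos: "\<And>i. \<beta> i > 0"
    and step_sizes:
      "lambda_min (diag_matrix \<beta> + (2 * (c + c\<^sub>0)) *\<^sub>R degree_matrix E - c *\<^sub>R laplacian E)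
         > \<theta>_bar\<^sup>2 / (2 * \<mu>_bar)"
    and run: "algorithm_run \<Omega> J E c c\<^sub>0 \<beta> x w"
  shows "(\<exists>!xs. is_nash \<Omega> J xs) \<and>
    (\<forall>xs. is_nash \<Omega> J xs \<longrightarrow>
      (\<forall>i. (\<lambda>k. x k $ i) \<longlonglongrightarrow> xs) \<and> x \<longlonglongrightarrow> (\<chi> i. xs))"
proof -
  let ?l2 = "lambda_2 (laplacian E)"
  have card: "CARD('n) \<ge> 2"
  proof -
    \<comment> \<open>A neighbour of \<open>i\<close> differs from \<open>i\<close> by
      irreflexivity, which yields the two players that \<open>lambda_2\<close> requires.\<close>
    fix i :: 'n
    obtain j where "j \<in> nbrs E i" using no_isolated[of i] by blast
    then have "i \<noteq> j" using undirected(2) by (auto simp: nbrs_def irrefl_def)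
    then have "card {i, j} = 2" by simp
    then show ?thesis using card_mono[of UNIV "{i, j}"] by simp
  qed
  have l2: "?l2 > 0" by (rule lambda_2_pos[OF undirected(1) graph_connected card])
  \<comment> \<open>The sign of \<open>c\<^sub>0\<close> is derived: \<open>c_min\<close> is
    positive because its product with the positive \<open>lambda_2\<close> is.\<close>
  have "0 < c_min * ?l2"
    unfolding c_min using mu_pos theta_pos by (intro add_nonneg_pos) auto
  then have c0: "c\<^sub>0 \<ge> 0" using l2 c0_gt by (simp add: zero_less_mult_iff)
  have "(\<theta> + \<theta>\<^sub>0)\<^sup>2 / (4 * \<mu>) + \<theta> < c\<^sub>0 * ?l2"
    using c0_gt l2 unfolding c_min[symmetric] by simp
  then have mu_bar_pos: "\<mu>_bar > 0"
    unfolding mu_bar using card mu_pos by (intro Psi_matrix_lambda_min_pos) auto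
  have cont: "continuous_on UNIV (pseudo_grad J)"
    using pseudo_lipschitz theta0_pos
    by (intro lipschitz_on_continuous_on[of \<theta>\<^sub>0] lipschitz_onI) (auto simp: dist_norm)
  have conv: "\<And>i. convex (\<Omega> i)" using action_sets by blast
  have "x \<longlonglongrightarrow> replicate_rows xs" if nash: "is_nash \<Omega> J xs" for xs
  proof (rule algorithm_converges[OF run])
    note VI = is_nash_iff_variational_inequality[of \<Omega> J, OF conv cost_C1 cost_convex]
    show "xs $ i \<in> \<Omega> i" for i using nash VI by blast
    show "0 \<le> partial_grad J i xs * (t - xs $ i)" if "t \<in> \<Omega> i" for i t
      using nash VI that by blast
    show "\<Omega> i \<noteq> {} \<and> closed (\<Omega> i) \<and> convex (\<Omega> i)" for i
      using action_sets compact_imp_closed by blast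
    show "\<mu>_bar * (norm (y - replicate_rows xs))\<^sup>2 \<le> (y - replicate_rows xs) \<bullet>
        (consensus_operator J E c\<^sub>0 y - consensus_operator J E c\<^sub>0 (replicate_rows xs))" for y
      unfolding mu_bar
      by (rule consensus_operator_restricted_monotone[OF undirected(1) graph_connected card c0
            strong_mono pseudo_lipschitz ext_lipschitz])
    show "norm (consensus_operator J E c\<^sub>0 y - consensus_operator J E c\<^sub>0 z) \<le> \<theta>_bar * norm (y - z)" for y z
      unfolding theta_bar by (rule consensus_operator_lipschitz[OF undirected(1) c0 ext_lipschitz])
    show "\<theta>_bar\<^sup>2 / (2 * \<mu>_bar) < lambda_min (step_matrix E c c\<^sub>0 \<beta>)"
      using step_sizes unfolding step_matrix_def .
  qed (use undirected(1) beta_pos c_pos c0 mu_bar_pos in simp_all)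
  then have conv_x: "x \<longlonglongrightarrow> (\<chi> i. xs)" if "is_nash \<Omega> J xs" for xs
    using that unfolding replicate_rows_def by blast
  then have "(\<lambda>k. x k $ i) \<longlonglongrightarrow> xs" if "is_nash \<Omega> J xs" for xs i
    using tendsto_vec_nth[OF conv_x[OF that], of i] by simp
  moreover have "\<exists>!xs. is_nash \<Omega> J xs"
  proof (rule ex_ex1I)
    show "\<exists>xs. is_nash \<Omega> J xs"
      by (rule nash_exists[OF action_sets cost_C1 cost_convex cont])
    show "y = z" if "is_nash \<Omega> J y" "is_nash \<Omega> J z" for y z
      by (rule nash_unique[OF conv cost_C1 cost_convex mu_pos strong_mono that])
  qed
  ultimately show ?thesis using conv_x by blast
qed

end
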